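(* Let $q\geq 7$ be an odd prime power and let $k$ be a positive integer. Then there exists a finite, simple, undirected, connected $C_4$-free graph of order $n=(q^2+q-1)k+1$, diameter $d=4k$, and edge-connectivity $\lambda\geq q-6$; in particular, $$d\geq \frac{4(n-1)}{\lambda^2-11\lambda+29}.$$
   Context: A graph is $C_4$-free if it contains no cycle of length four as a (not necessarily induced) subgraph. The edge-connectivity $\lambda$ of a connected graph is the minimum number of edges whose removal disconnects it.
   Formalization: The closing inequality d ≥ 4(n−1)/(λ²−11λ+29) is omitted because it is false as printed (for q=13, k=1 every such graph has 7≤λ≤13, so the right side exceeds 13 while d=4); the bound that follows from λ≥q−6 has denominator λ²+13λ+41. *)

theory Defs
  imports Main "HOL-Computational_Algebra.Primes"
begin

definition simple_graph :: "'a set \<Rightarrow> 'a set set \<Rightarrow> bool" where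
  "simple_graph V E \<longleftrightarrow> finite V \<and> (\<forall>e\<in>E. e \<subseteq> V \<and> card e = 2)"

definition is_walk :: "'a set \<Rightarrow> 'a set set \<Rightarrow> 'a list \<Rightarrow> bool" where
  "is_walk V E xs \<longleftrightarrow> xs \<noteq> [] \<and> set xs \<subseteq> V \<and>
     (\<forall>i. Suc i < length xs \<longrightarrow> {xs ! i, xs ! Suc i} \<in> E)"

definition connected_graph :: "'a set \<Rightarrow> 'a set set \<Rightarrow> bool" where
  "connected_graph V E \<longleftrightarrow> V \<noteq> {} \<and>
     (\<forall>u\<in>V. \<forall>v\<in>V. \<exists>xs. is_walk V E xs \<and> hd xs = u \<and> last xs = v)"

definition graph_dist :: "'a set \<Rightarrow> 'a set set \<Rightarrow> 'a \<Rightarrow> 'a \<Rightarrow> nat" where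
  "graph_dist V E u v = (LEAST n. \<exists>xs. is_walk V E xs \<and> hd xs = u \<and> last xs = v \<and> length xs = Suc n)"

definition diameter :: "'a set \<Rightarrow> 'a set set \<Rightarrow> nat" where
  "diameter V E = Max {graph_dist V E u v | u v. u \<in> V \<and> v \<in> V}"

definition C4_free :: "'a set \<Rightarrow> 'a set set \<Rightarrow> bool" where
  "C4_free V E \<longleftrightarrow> \<not> (\<exists>a b c d. distinct [a, b, c, d] \<and> {a, b, c, d} \<subseteq> V \<and>
      {a, b} \<in> E \<and> {b, c} \<in> E \<and> {c, d} \<in> E \<and> {d, a} \<in> E)"

definition edge_connectivity :: "'a set \<Rightarrow> 'a set set \<Rightarrow> nat" where
  "edge_connectivity V E = (LEAST m. \<exists>F. F \<subseteq> E \<and> card F = m \<and> \<not> connected_graph V (E - F))"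

definition prime_power :: "nat \<Rightarrow> bool" where
  "prime_power q \<longleftrightarrow> (\<exists>p m. prime p \<and> m \<ge> 1 \<and> q = p ^ m)"

end

theory Submission
  imports Defs "Jordan_Normal_Form.Char_Poly"
begin

text \<open>
  Over a field with \<open>q\<close> elements, take \<open>q\<close> stars (columns) with centres \<open>[a]\<close> and leaves
  \<open>(a, b)\<close>, and join \<open>(a, b)\<close> to \<open>(c, ac - b)\<close>. This is the polarity graph of the projective plane
  without one absolute vertex; two vertices have at most one common neighbour. Deleting the
  matching between the columns 0 and 1 puts \<open>[0]\<close> and \<open>[1]\<close> at distance 4, and any two
  vertices can still be joined by a walk of length at most 4 through a third column. If fewer than
  \<open>q - 6\<close> edges are deleted from this block, columns whose star is untouched remain, and every
  vertex still reaches one of them. Identifying the vertex \<open>[1]\<close> of each of \<open>k\<close> blocks with the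
  vertex \<open>[0]\<close> of the next yields the graph.

  The field with \<open>q = p ^ m\<close> elements is a residue ring: \<open>A\<close> is a ring of algebraic integers
  containing the \<open>(q - 1)\<close>-th roots of unity and \<open>M\<close> a prime ideal of \<open>A\<close> containing \<open>p\<close>. The
  complex solutions \<open>s\<close> of \<open>s ^ q = s\<close> are pairwise incongruent modulo \<open>M\<close>; they are closed under
  the field operations modulo \<open>M\<close>, because \<open>x ^ q - x\<close> is the product of all \<open>x - s\<close>.
\<close>

section \<open>Finite fields\<close>

text \<open>With \<open>v i = z ^ i\<close> for a root of unity \<open>z\<close>, this ring contains \<open>z\<close>; its elements are
  eigenvalues of integer matrices, hence algebraic integers.\<close>

definition multiplier_ring :: "nat \<Rightarrow> (nat \<Rightarrow> complex) \<Rightarrow> complex set" where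
  "multiplier_ring n v =
     {x. \<exists>C :: nat \<Rightarrow> nat \<Rightarrow> int. \<forall>i<n. x * v i = (\<Sum>j<n. of_int (C i j) * v j)}"

lemma multiplier_ring_add:
  assumes "x \<in> multiplier_ring n v" "y \<in> multiplier_ring n v"
  shows "x + y \<in> multiplier_ring n v"
proof -
  obtain C D :: "nat \<Rightarrow> nat \<Rightarrow> int"
    where "\<forall>i<n. x * v i = (\<Sum>j<n. of_int (C i j) * v j)"
      and "\<forall>i<n. y * v i = (\<Sum>j<n. of_int (D i j) * v j)"
    using assms by (auto simp: multiplier_ring_def)
  then have "\<forall>i<n. (x + y) * v i = (\<Sum>j<n. of_int (C i j + D i j) * v j)"
    by (simp add: distrib_right sum.distrib)
  then show ?thesis unfolding multiplier_ring_def
    by (intro CollectI exI[of _ "\<lambda>i j. C i j + D i j"])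
qed

lemma multiplier_ring_mult:
  assumes "x \<in> multiplier_ring n v" "y \<in> multiplier_ring n v"
  shows "x * y \<in> multiplier_ring n v"
proof -
  obtain C D :: "nat \<Rightarrow> nat \<Rightarrow> int"
    where C: "\<forall>i<n. x * v i = (\<Sum>j<n. of_int (C i j) * v j)"
      and D: "\<forall>i<n. y * v i = (\<Sum>j<n. of_int (D i j) * v j)"
    using assms by (auto simp: multiplier_ring_def)
  have "x * y * v i = (\<Sum>k<n. of_int (\<Sum>j<n. D i j * C j k) * v k)" if "i < n" for i
  proof -
    have "x * y * v i = (\<Sum>j<n. of_int (D i j) * (x * v j))"
      using D that by (simp add: sum_distrib_left mult_ac)
    also have "\<dots> = (\<Sum>j<n. \<Sum>k<n. of_int (D i j) * of_int (C j k) * v k)"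
      using C by (simp add: sum_distrib_left mult_ac)
    also have "\<dots> = (\<Sum>k<n. \<Sum>j<n. of_int (D i j) * of_int (C j k) * v k)"
      by (rule sum.swap)
    finally show ?thesis by (simp add: sum_distrib_right)
  qed
  then show ?thesis unfolding multiplier_ring_def
    by (intro CollectI exI[of _ "\<lambda>i k. \<Sum>j<n. D i j * C j k"]) auto
qed

lemma multiplier_ring_of_int: "of_int c \<in> multiplier_ring n v"
proof -
  have "of_int c * v i = (\<Sum>j<n. of_int (if j = i then c else 0) * v j)" if "i < n" for i
    using that by (simp add: if_distrib[of of_int] if_distrib[of "\<lambda>t. t * _"] cong: if_cong)
  then show ?thesis unfolding multiplier_ring_def
    by (intro CollectI exI[of _ "\<lambda>i j. if j = i then c else 0"]) auto
qed

text \<open>Multiplication by \<open>z\<close> shifts the powers of \<open>z\<close> cyclically, so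
  its coefficient matrix is a permutation matrix.\<close>

lemma root_of_unity_in_multiplier_ring:
  assumes "z ^ n = 1" "n > 0"
  shows "z \<in> multiplier_ring n ((^) z)"
proof -
  have "z * z ^ i = (\<Sum>j<n. of_int (if j = Suc i mod n then 1 else 0) * z ^ j)" if "i < n" for i
  proof -
    have "z * z ^ i = z ^ (Suc i mod n)"
      using that assms by (cases "Suc i = n") auto
    moreover have "Suc i mod n < n" using assms by simp
    ultimately show ?thesis
      by (simp add: if_distrib[of of_int] if_distrib[of "\<lambda>t. t * _"] cong: if_cong)
  qed
  then show ?thesis unfolding multiplier_ring_def
    by (intro CollectI exI[of _ "\<lambda>i j. if j = Suc i mod n then 1 else 0"]) auto
qed

text \<open>The vector \<open>v\<close> is an eigenvector of the coefficient matrix \<open>C\<close>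
  for the eigenvalue \<open>x\<close>, so \<open>x\<close> is a root of a monic integer
  characteristic polynomial. The nonzero entry \<open>v i\<close> makes it a genuine
  eigenvector.\<close>

lemma multiplier_ring_algebraic_int:
  assumes "x \<in> multiplier_ring n v" "i < n" "v i \<noteq> 0"
  shows "algebraic_int x"
proof -
  obtain C :: "nat \<Rightarrow> nat \<Rightarrow> int"
    where C: "\<forall>i<n. x * v i = (\<Sum>j<n. of_int (C i j) * v j)"
    using assms by (auto simp: multiplier_ring_def)
  define M where "M = mat n n (\<lambda>(i, j). C i j)"
  define Mc :: "complex mat" where "Mc = map_mat of_int M"
  have M: "M \<in> carrier_mat n n" and Mc: "Mc \<in> carrier_mat n n"
    by (auto simp: M_def Mc_def)
  have "Mc *\<^sub>v vec n v = x \<cdot>\<^sub>v vec n v"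
    using C by (intro eq_vecI) (auto simp: Mc_def M_def scalar_prod_def atLeast0LessThan)
  moreover have "vec n v \<noteq> 0\<^sub>v n"
    using assms by (metis index_vec index_zero_vec(1))
  ultimately have "eigenvalue Mc x"
    unfolding eigenvalue_def eigenvector_def using Mc by (intro exI[of _ "vec n v"]) auto
  then have "poly (map_poly of_int (char_poly M)) x = 0"
    using eigenvalue_root_char_poly[OF Mc] of_int_hom.char_poly_hom[OF M, where ?'a = complex]
    by (simp add: Mc_def)
  moreover have "lead_coeff (char_poly M) = 1"
    using degree_monic_char_poly[OF M] by simp
  ultimately show ?thesis by (auto simp: algebraic_int_altdef_ipoly)
qed

section \<open>Subrings, prime ideals and the Frobenius congruence\<close>

locale subring_set =
  fixes A :: "'a :: comm_ring_1 set"
  assumes add: "x \<in> A \<Longrightarrow> y \<in> A \<Longrightarrow> x + y \<in> A"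
    and mult: "x \<in> A \<Longrightarrow> y \<in> A \<Longrightarrow> x * y \<in> A"
    and of_int: "of_int c \<in> A"
begin

definition ideal_of :: "'a set \<Rightarrow> bool" where
  "ideal_of I \<longleftrightarrow> I \<subseteq> A \<and> 0 \<in> I \<and> (\<forall>x\<in>I. \<forall>y\<in>I. x + y \<in> I) \<and> (\<forall>x\<in>I. \<forall>a\<in>A. a * x \<in> I)"

lemma one: "1 \<in> A"
  using of_int[of 1] by simp

text \<open>Zorn's lemma gives an ideal maximal among those that contain \<open>z\<close> but not 1;
  the multiples of \<open>z\<close> form such an ideal because \<open>z\<close> is not invertible.
  Maximality forces primality.\<close>

lemma prime_ideal_containing:
  assumes z: "z \<in> A" and nonunit: "\<And>a. a \<in> A \<Longrightarrow> a * z \<noteq> 1"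
  obtains M where "ideal_of M" "z \<in> M" "1 \<notin> M"
    "\<And>x y. x \<in> A \<Longrightarrow> y \<in> A \<Longrightarrow> x * y \<in> M \<Longrightarrow> x \<in> M \<or> y \<in> M"
proof -
  define P where "P = {I. ideal_of I \<and> z \<in> I \<and> 1 \<notin> I}"
  have zA: "(\<lambda>a. a * z) ` A \<in> P"
  proof -
    have "ideal_of ((\<lambda>a. a * z) ` A)"
      unfolding ideal_of_def
    proof (intro conjI ballI)
      show "(\<lambda>a. a * z) ` A \<subseteq> A" using z mult by auto
      show "0 \<in> (\<lambda>a. a * z) ` A" using of_int[of 0] by (intro image_eqI[of _ _ 0]) auto
      fix x assume "x \<in> (\<lambda>a. a * z) ` A"
      then obtain a where a: "a \<in> A" "x = a * z" by auto
      show "x + y \<in> (\<lambda>a. a * z) ` A" if y: "y \<in> (\<lambda>a. a * z) ` A" for y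
        using y a add by (auto intro!: image_eqI[of _ _ "a + _"] simp: distrib_right)
      show "b * x \<in> (\<lambda>a. a * z) ` A" if b: "b \<in> A" for b
        using b a mult by (auto intro!: image_eqI[of _ _ "b * a"] simp: mult_ac)
    qed
    moreover have "z \<in> (\<lambda>a. a * z) ` A" using one by (intro image_eqI[of _ _ 1]) auto
    moreover have "1 \<notin> (\<lambda>a. a * z) ` A" using nonunit by force
    ultimately show ?thesis by (auto simp: P_def)
  qed
  have "\<Union>C \<in> P" if C: "C \<noteq> {}" "subset.chain P C" for C
  proof -
    have sub: "C \<subseteq> P" and lin: "\<And>I J. I \<in> C \<Longrightarrow> J \<in> C \<Longrightarrow> I \<subseteq> J \<or> J \<subseteq> I"
      using C(2) by (auto simp: subset.chain_def)
    have "x + y \<in> \<Union>C" if "x \<in> \<Union>C" "y \<in> \<Union>C" for x y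
    proof -
      from \<open>x \<in> \<Union>C\<close> \<open>y \<in> \<Union>C\<close> obtain I J
        where IJ: "I \<in> C" "J \<in> C" "x \<in> I" "y \<in> J" by blast
      then obtain K where K: "K \<in> C" "x \<in> K" "y \<in> K" using lin[of I J] by blast
      then have "ideal_of K" using sub by (auto simp: P_def)
      then show ?thesis using K by (auto simp: ideal_of_def)
    qed
    moreover have "a * x \<in> \<Union>C" if "x \<in> \<Union>C" "a \<in> A" for x a
      using that sub by (auto simp: P_def ideal_of_def)
    moreover have "\<Union>C \<subseteq> A" "0 \<in> \<Union>C" "z \<in> \<Union>C" "1 \<notin> \<Union>C"
      using sub C(1) by (auto simp: P_def ideal_of_def)
    ultimately show ?thesis by (auto simp: P_def ideal_of_def)
  qed
  then obtain M where M: "M \<in> P" and max: "\<And>X. X \<in> P \<Longrightarrow> M \<subseteq> X \<Longrightarrow> X = M"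
    using subset_Zorn_nonempty[of P] zA by blast
  have idM: "ideal_of M" "z \<in> M" "1 \<notin> M" using M by (auto simp: P_def)
  have "y \<in> M" if x: "x \<in> A" and y: "y \<in> A" and xy: "x * y \<in> M" and nx: "x \<notin> M" for x y
  proof -
    \<comment> \<open>\<open>J\<close> is the ideal generated by \<open>M\<close> and
      \<open>x\<close>. It is strictly larger than \<open>M\<close>, so by maximality it contains
      1.\<close>
    define J where "J = {m + a * x | m a. m \<in> M \<and> a \<in> A}"
    have MJ: "M \<subseteq> J"
    proof
      fix m assume "m \<in> M"
      then show "m \<in> J"
        unfolding J_def using of_int[of 0] by (intro CollectI exI[of _ m] exI[of _ 0]) auto
    qed
    have xJ: "x \<in> J"
      unfolding J_def using idM(1) one
      by (intro CollectI exI[of _ 0] exI[of _ 1]) (auto simp: ideal_of_def)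
    have "ideal_of J"
      unfolding ideal_of_def
    proof (intro conjI ballI)
      show "J \<subseteq> A" using idM(1) x add mult by (auto simp: J_def ideal_of_def)
      show "0 \<in> J" using MJ idM(1) by (auto simp: ideal_of_def)
      fix u assume "u \<in> J"
      then obtain m a where u: "m \<in> M" "a \<in> A" "u = m + a * x" by (auto simp: J_def)
      show "u + w \<in> J" if "w \<in> J" for w
      proof -
        from \<open>w \<in> J\<close> obtain m' a' where w: "m' \<in> M" "a' \<in> A" "w = m' + a' * x"
          by (auto simp: J_def)
        show ?thesis unfolding J_def using u w idM(1) add
          by (intro CollectI exI[of _ "m + m'"] exI[of _ "a + a'"])
             (auto simp: ideal_of_def algebra_simps)
      qed
      show "b * u \<in> J" if "b \<in> A" for b
        unfolding J_def using u that idM(1) mult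
        by (intro CollectI exI[of _ "b * m"] exI[of _ "b * a"])
           (auto simp: ideal_of_def algebra_simps)
    qed
    then have "1 \<in> J" using max[of J] MJ xJ nx idM(2) by (auto simp: P_def)
    then obtain m a where "m \<in> M" "a \<in> A" "1 = m + a * x" by (auto simp: J_def)
    \<comment> \<open>Multiply \<open>1 = m + a * x\<close> by \<open>y\<close>.\<close>
    then have "y = y * m + a * (x * y)"
      by (metis distrib_left mult.commute mult.left_commute mult_1)
    moreover have "y * m \<in> M" "a * (x * y) \<in> M"
      using \<open>m \<in> M\<close> \<open>a \<in> A\<close> y xy idM(1) by (auto simp: ideal_of_def)
    ultimately show ?thesis using idM(1) unfolding ideal_of_def by metis
  qed
  then show ?thesis using that idM by blast
qed

lemma minus: "x \<in> A \<Longrightarrow> - x \<in> A"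
  using mult[OF of_int[of "-1"]] by force

lemma power: "x \<in> A \<Longrightarrow> x ^ k \<in> A"
  by (induction k) (auto intro: one mult)

lemma sum: "(\<And>i. i \<in> I \<Longrightarrow> f i \<in> A) \<Longrightarrow> sum f I \<in> A"
  using of_int[of 0] by (induction I rule: infinite_finite_induct) (auto intro: add)

lemma ideal_sum: "ideal_of M \<Longrightarrow> (\<And>i. i \<in> I \<Longrightarrow> f i \<in> M) \<Longrightarrow> sum f I \<in> M"
  by (induction I rule: infinite_finite_induct) (auto simp: ideal_of_def)

lemma ideal_diff: "ideal_of M \<Longrightarrow> x \<in> M \<Longrightarrow> y \<in> M \<Longrightarrow> x - y \<in> M"
  using minus[OF one] by (metis diff_conv_add_uminus ideal_of_def mult_minus1)

text \<open>The inner binomial coefficients are divisible by \<open>p\<close>, so all mixed terms of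
  the expansion lie in \<open>M\<close>.\<close>

lemma ideal_freshman:
  assumes M: "ideal_of M" and p: "prime p" "of_nat p \<in> M" and xy: "x \<in> A" "y \<in> A"
  shows "(x + y) ^ p - (x ^ p + y ^ p) \<in> M"
proof -
  have p0: "p > 0" using p(1) prime_gt_0_nat by blast
  have "(x + y) ^ p = (\<Sum>k\<le>p. of_nat (p choose k) * x ^ k * y ^ (p - k))"
    by (rule binomial_ring)
  also have "{..p} = insert 0 (insert p {0<..<p})" using p0 by auto
  also have "(\<Sum>k\<in>\<dots>. of_nat (p choose k) * x ^ k * y ^ (p - k)) =
      x ^ p + y ^ p + (\<Sum>k\<in>{0<..<p}. of_nat (p choose k) * x ^ k * y ^ (p - k))"
    using p0 by simp
  finally have eq: "(x + y) ^ p - (x ^ p + y ^ p) =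
      (\<Sum>k\<in>{0<..<p}. of_nat (p choose k) * x ^ k * y ^ (p - k))" by simp
  have "of_nat (p choose k) * x ^ k * y ^ (p - k) \<in> M" if "k \<in> {0<..<p}" for k
  proof -
    \<comment> \<open>Absorption:
      \<open>k * (p choose k) = p * ((p - 1) choose (k - 1))\<close>.\<close>
    have "p dvd k * (p choose k)" using that by (simp add: times_binomial_minus1_eq)
    moreover have "\<not> p dvd k" using that by (auto dest: dvd_imp_le)
    ultimately have "p dvd (p choose k)" using p(1) prime_dvd_mult_iff by blast
    then obtain c where "p choose k = p * c" by blast
    then have "of_nat (p choose k) * x ^ k * y ^ (p - k) =
        (of_int (int c) * x ^ k * y ^ (p - k)) * of_nat p"
      by (simp add: mult_ac)
    moreover have "of_int (int c) * x ^ k * y ^ (p - k) \<in> A"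
      by (intro mult power xy of_int)
    ultimately show ?thesis using M p(2) by (simp add: ideal_of_def)
  qed
  then show ?thesis unfolding eq by (intro ideal_sum[OF M]) auto
qed

lemma ideal_freshman_power:
  assumes M: "ideal_of M" and p: "prime p" "of_nat p \<in> M" and xy: "x \<in> A" "y \<in> A"
  shows "(x + y) ^ (p ^ m) - (x ^ (p ^ m) + y ^ (p ^ m)) \<in> M"
proof (induction m)
  case 0
  then show ?case using M by (auto simp: ideal_of_def)
next
  case (Suc m)
  define u v w where "u = x ^ (p ^ m)" "v = y ^ (p ^ m)" "w = (x + y) ^ (p ^ m)"
  \<comment> \<open>\<open>t\<close> is the error term of the induction hypothesis. Expanding
    \<open>(u + v + t) ^ p\<close> by two uses of the prime case leaves, besides
    \<open>u ^ p + v ^ p\<close>, only elements of \<open>M\<close>.\<close>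
  define t where "t = w - (u + v)"
  have t: "t \<in> M" using Suc by (simp add: t_def u_v_w_def)
  have tA: "t \<in> A" using t M by (auto simp: ideal_of_def)
  have uv: "u \<in> A" "v \<in> A" by (auto simp: u_v_w_def xy power)
  have p0: "p > 0" using p(1) prime_gt_0_nat by blast
  have "(u + v + t) ^ p - ((u + v) ^ p + t ^ p) \<in> M"
    by (rule ideal_freshman[OF M p]) (auto intro: uv add tA)
  moreover have "(u + v) ^ p - (u ^ p + v ^ p) \<in> M"
    by (rule ideal_freshman[OF M p uv])
  moreover have "t ^ p \<in> M"
    using t tA M p0 power[OF tA] by (cases p) (auto simp: ideal_of_def mult.commute)
  ultimately have "((u + v + t) ^ p - ((u + v) ^ p + t ^ p)) + ((u + v) ^ p - (u ^ p + v ^ p)) + t ^ p \<in> M"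
    using M unfolding ideal_of_def by blast
  moreover have "w = u + v + t" by (simp add: t_def)
  ultimately have "w ^ p - (u ^ p + v ^ p) \<in> M" by (simp add: algebra_simps)
  then show ?case
    by (simp add: u_v_w_def mult.commute[of p] flip: power_mult)
qed

lemma prime_ideal_prod:
  assumes "\<And>x y. x \<in> A \<Longrightarrow> y \<in> A \<Longrightarrow> x * y \<in> M \<Longrightarrow> x \<in> M \<or> y \<in> M" "1 \<notin> M"
    and "finite I" "\<And>i. i \<in> I \<Longrightarrow> f i \<in> A" "prod f I \<in> M"
  shows "\<exists>i\<in>I. f i \<in> M"
  using assms(3-)
proof (induction I rule: finite_induct)
  case empty
  then show ?case using assms(2) by simp
next
  case (insert i I)
  have "prod f I \<in> A"
    using insert.prems(1) insert.hyps(1)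
    by (induction I rule: infinite_finite_induct) (auto intro: one mult)
  then show ?case using insert assms(1)[of "f i" "prod f I"] by auto
qed

end

section \<open>The complex solutions of \<open>z ^ q = z\<close>, and the field they
  represent\<close>

lemma card_power_fixpoints:
  assumes "q \<ge> 2"
  shows "finite {z :: complex. z ^ q = z}" "card {z :: complex. z ^ q = z} = q"
proof -
  have "(z ^ q = z) = (z = 0 \<or> z ^ (q - 1) = 1)" for z :: complex
    using assms by (cases q) auto
  then have eq: "{z :: complex. z ^ q = z} = insert 0 {z. z ^ (q - 1) = 1}" by auto
  have fin: "finite {z :: complex. z ^ (q - 1) = 1}"
    using assms by (intro finite_roots_unity) auto
  have "card {z :: complex. z ^ (q - 1) = 1} = q - 1"
    using assms by (intro card_roots_unity_eq) auto
  then show "finite {z :: complex. z ^ q = z}" "card {z :: complex. z ^ q = z} = q"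
    using fin assms unfolding eq by (auto simp: card_insert_if power_0_left)
qed

text \<open>Two monic polynomials of degree \<open>q\<close> that agree at the \<open>q\<close>
  points of \<open>S\<close> are equal.\<close>

lemma prod_power_fixpoints:
  assumes "q \<ge> 2"
  shows "(\<Prod>s | s ^ q = s. x - s) = x ^ q - (x :: complex)"
proof -
  define S where "S = {z :: complex. z ^ q = z}"
  define P where "P = (\<Prod>s\<in>S. [:- s, 1:])"
  define Q where "Q = monom 1 q - [:0, 1 :: complex:]"
  have fin: "finite S" and card: "card S = q"
    using card_power_fixpoints[OF assms] by (auto simp: S_def)
  have degQ: "degree Q = q"
    unfolding Q_def using assms
    by (subst diff_conv_add_uminus, subst degree_add_eq_left) (auto simp: degree_monom_eq)
  have degP: "degree P = q"
    unfolding P_def by (subst degree_prod_eq_sum_degree) (auto simp: card)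
  have "lead_coeff P = 1" unfolding P_def by (simp add: lead_coeff_prod)
  moreover have "lead_coeff Q = 1" unfolding degQ using assms
    by (auto simp: Q_def coeff_pCons split: nat.splits)
  ultimately have "P = Q"
    using fin card degP degQ
    by (intro poly_eqI_degree_lead_coeff[of P q Q S]) (auto simp: P_def Q_def S_def poly_prod poly_monom)
  then have "poly P x = poly Q x" by simp
  then show ?thesis by (simp add: P_def Q_def S_def poly_prod poly_monom)
qed

text \<open>In a field, \<open>\<sigma> a c b = ac - b\<close>.\<close>

locale planar_operation =
  fixes q :: nat and \<sigma> :: "nat \<Rightarrow> nat \<Rightarrow> nat \<Rightarrow> nat"
  assumes \<sigma>_less: "a < q \<Longrightarrow> c < q \<Longrightarrow> b < q \<Longrightarrow> \<sigma> a c b < q"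
    and \<sigma>_commute: "\<sigma> a c b = \<sigma> c a b"
    and \<sigma>_invol: "a < q \<Longrightarrow> c < q \<Longrightarrow> b < q \<Longrightarrow> \<sigma> a c (\<sigma> a c b) = b"
    and \<sigma>_planar: "a < q \<Longrightarrow> a' < q \<Longrightarrow> c < q \<Longrightarrow> c' < q \<Longrightarrow> b < q \<Longrightarrow> b' < q \<Longrightarrow>
       \<sigma> a c b = \<sigma> a' c b' \<Longrightarrow> \<sigma> a c' b = \<sigma> a' c' b' \<Longrightarrow> a = a' \<or> c = c'"
    and q_ge: "q \<ge> 7"

text \<open>The field is never formed as a type: \<open>S\<close> serves as a set of representatives
  modulo \<open>M\<close> (Teichmueller representatives), and \<open>\<beta>\<close> numbers them by
  the naturals below \<open>q\<close>.\<close>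

lemma planar_operation_exists:
  assumes "prime_power q" "odd q" "q \<ge> 7"
  obtains \<sigma> where "planar_operation q \<sigma>"
proof -
  obtain p m where p: "prime p" and m: "m \<ge> 1" and q: "q = p ^ m"
    using assms by (auto simp: prime_power_def)
  have q2: "q \<ge> 2"
    using prime_ge_2_nat[OF p] m self_le_power[of p m] q by auto
  define n where "n = q - 1"
  have n0: "n > 0" and qn: "q = Suc n" using q2 by (auto simp: n_def)
  define \<zeta> where "\<zeta> = cis (2 * pi / n)"
  have \<zeta>n: "\<zeta> ^ n = 1" using n0 by (simp add: \<zeta>_def DeMoivre)
  define A where "A = multiplier_ring n ((^) \<zeta>)"
  interpret subring_set A
    by unfold_locales
       (auto simp: A_def multiplier_ring_add multiplier_ring_mult multiplier_ring_of_int)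
  have pA: "(of_nat p :: complex) \<in> A" using of_int[of "int p"] by simp
  \<comment> \<open>\<open>1 / p\<close> is rational but not an integer, hence not an algebraic
    integer.\<close>
  have nonunit: "a * of_nat p \<noteq> 1" if "a \<in> A" for a
  proof
    assume *: "a * of_nat p = 1"
    then have a: "a = 1 / of_nat p" using prime_gt_0_nat[OF p] by (simp add: field_simps)
    have "algebraic_int a"
      using that n0 by (auto simp: A_def intro: multiplier_ring_algebraic_int[of _ n "(^) \<zeta>" 0])
    then have "a \<in> \<int>" using a by (intro rational_algebraic_int_is_int) auto
    then obtain k where "a = of_int k" by (auto simp: Ints_def)
    with * have "of_int (k * int p) = (1 :: complex)" by simp
    then have "k * int p = 1" by (metis of_int_eq_1_iff)
    then show False using prime_gt_1_nat[OF p] by (auto simp: zmult_eq_1_iff)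
  qed
  obtain M where M: "ideal_of M" "of_nat p \<in> M" "1 \<notin> M"
    and prime: "\<And>x y. x \<in> A \<Longrightarrow> y \<in> A \<Longrightarrow> x * y \<in> M \<Longrightarrow> x \<in> M \<or> y \<in> M"
    using prime_ideal_containing[OF pA nonunit] by metis
  have Madd: "\<And>x y. x \<in> M \<Longrightarrow> y \<in> M \<Longrightarrow> x + y \<in> M"
    and Mmult: "\<And>a x. a \<in> A \<Longrightarrow> x \<in> M \<Longrightarrow> a * x \<in> M"
    and Mdiff: "\<And>x y. x \<in> M \<Longrightarrow> y \<in> M \<Longrightarrow> x - y \<in> M"
    using M(1) ideal_diff[OF M(1)] by (auto simp: ideal_of_def)
  define S where "S = {z :: complex. z ^ q = z}"
  have finS: "finite S" and cardS: "card S = q"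
    using card_power_fixpoints[OF q2] by (auto simp: S_def)
  have S_unit: "s ^ n = 1" if "s \<in> S" "s \<noteq> 0" for s
    using that by (simp add: S_def qn)
  have SA: "s \<in> A" if "s \<in> S" for s
  proof (cases "s = 0")
    case True
    then show ?thesis using of_int[of 0] by simp
  next
    case False
    then have "s \<in> {z. z ^ n = 1}" using S_unit that by simp
    then have "s \<in> (\<lambda>k. cis (2 * pi * real k / real n)) ` {..<n}"
      using bij_betw_roots_unity[OF n0] by (simp add: bij_betw_def)
    then obtain k where "s = cis (2 * pi * real k / real n)" by auto
    then have "s = \<zeta> ^ k" by (simp add: \<zeta>_def DeMoivre mult_ac)
    moreover have "\<zeta> \<in> A" unfolding A_def
      by (rule root_of_unity_in_multiplier_ring[OF \<zeta>n n0])
    ultimately show ?thesis using power by simp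
  qed
  have unit_notin_M: "s = 0" if "s \<in> S" "s \<in> M" for s
  proof (rule ccontr)
    assume "s \<noteq> 0"
    \<comment> \<open>A nonzero \<open>s\<close> has the inverse \<open>s ^ (n - 1)\<close> in
      \<open>A\<close>, so an ideal containing \<open>s\<close> would contain 1.\<close>
    then have "s ^ (n - 1) * s = 1" using S_unit[OF that(1)] n0 by (cases n) (auto simp: mult.commute)
    then show False using Mmult[OF power[OF SA[OF that(1)]] that(2)] M(3) by metis
  qed
  have inj: "s = t" if s: "s \<in> S" and t: "t \<in> S" and st: "s - t \<in> M" for s t
  proof (cases "s = 0 \<or> t = 0")
    case True
    then show ?thesis
      using unit_notin_M[of s] unit_notin_M[of t] s t st Mdiff[of 0 "s - t"] M(1)
      by (auto simp: ideal_of_def)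
  next
    case False
    \<comment> \<open>\<open>y\<close> stands for \<open>s / t\<close>, as
      \<open>t ^ (n - 1)\<close> is the inverse of \<open>t\<close>.\<close>
    define y where "y = s * t ^ (n - 1)"
    have tn: "t * t ^ (n - 1) = 1" using S_unit[OF t] False n0 by (cases n) auto
    have yA: "y \<in> A" using SA s t by (auto simp: y_def intro: mult power)
    have yn: "y ^ n = 1"
      using S_unit[OF s] S_unit[OF t] False
      by (simp add: y_def power_mult_distrib flip: power_mult) (simp add: power_mult mult.commute)
    have "y - 1 = t ^ (n - 1) * (s - t)" using tn by (simp add: y_def algebra_simps)
    then have y1: "y - 1 \<in> M" using Mmult[OF power[OF SA[OF t]] st] by simp
    have "y = 1"
    proof (rule ccontr)
      assume "y \<noteq> 1"
      \<comment> \<open>The geometric sum vanishes although each of its \<open>n\<close> summands is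
        1 modulo \<open>M\<close>. So \<open>n = q - 1\<close> would lie in \<open>M\<close>, and
        since \<open>q\<close> does too, so would 1.\<close>
      then have "(\<Sum>i<n. y ^ i) = 0" using power_diff_1_eq[of y n] yn by simp
      then have "of_nat n = (\<Sum>i<n. 1 - y ^ i)" by (simp add: sum_subtractf)
      also have "\<dots> \<in> M"
      proof (rule ideal_sum[OF M(1)])
        fix i
        have "(\<Sum>j<i. y ^ j) * (y - 1) \<in> M" using y1 yA by (intro Mmult sum power)
        then have "y ^ i - 1 \<in> M" by (simp add: power_diff_1_eq mult.commute)
        then show "1 - y ^ i \<in> M" using Mdiff[of 0 "y ^ i - 1"] M(1) by (auto simp: ideal_of_def)
      qed
      finally have "of_nat n \<in> M" .
      moreover have "of_nat q \<in> M"
      proof -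
        have "of_nat q = of_int (int (p ^ (m - 1))) * (of_nat p :: complex)"
          using m q by (cases m) auto
        then show ?thesis using Mmult[OF of_int M(2)] by metis
      qed
      moreover have "1 = of_nat q - (of_nat n :: complex)" by (simp add: qn)
      ultimately show False using Mdiff M(3) by metis
    qed
    have "s = s * (t * t ^ (n - 1))" unfolding tn by simp
    also have "\<dots> = t * y" by (simp add: y_def mult_ac)
    finally show ?thesis using \<open>y = 1\<close> by simp
  qed
  \<comment> \<open>Existence of a representative: \<open>x ^ q - x\<close> lies in
    \<open>M\<close>, it is the product of the \<open>x - s\<close>, and \<open>M\<close> is
    prime.\<close>
  have rep: "\<exists>s\<in>S. a * c - b - s \<in> M" if "a \<in> S" "c \<in> S" "b \<in> S" for a c b
  proof -
    define x where "x = a * c - b"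
    have ac: "a * c \<in> A" and b: "- b \<in> A" using that SA by (auto intro: mult minus)
    then have xA: "x \<in> A" unfolding x_def using add by fastforce
    have "(a * c + - b) ^ q - ((a * c) ^ q + (- b) ^ q) \<in> M"
      unfolding q by (rule ideal_freshman_power[OF M(1) p M(2) ac b])
    \<comment> \<open>Oddness of \<open>q\<close> gives \<open>(- b) ^ q = - b\<close>.\<close>
    moreover have "(a * c) ^ q = a * c" "(- b) ^ q = - b"
      using that assms(2) by (auto simp: S_def power_mult_distrib)
    ultimately have "x ^ q - x \<in> M" by (simp add: x_def)
    then have "(\<Prod>s\<in>S. x - s) \<in> M" unfolding S_def by (simp add: prod_power_fixpoints[OF q2])
    moreover have "x - s \<in> A" if "s \<in> S" for s
      using add[OF xA minus[OF SA[OF that]]] by simp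
    ultimately show ?thesis
      using prime_ideal_prod[OF prime M(3) finS, of "\<lambda>s. x - s"] by (auto simp: x_def)
  qed
  define \<tau> where "\<tau> a c b = (SOME s. s \<in> S \<and> a * c - b - s \<in> M)" for a c b
  have \<tau>: "\<tau> a c b \<in> S \<and> a * c - b - \<tau> a c b \<in> M" if "a \<in> S" "c \<in> S" "b \<in> S" for a c b
    unfolding \<tau>_def by (rule someI_ex) (use rep[OF that] in blast)
  obtain \<beta> where \<beta>: "bij_betw \<beta> {..<q} S"
    using ex_bij_betw_nat_finite[OF finS] cardS by (auto simp: atLeast0LessThan)
  have \<beta>S: "\<beta> i \<in> S" if "i < q" for i using \<beta> that by (auto simp: bij_betw_def)
  have \<beta>inj: "i = j" if "\<beta> i - \<beta> j \<in> M" "i < q" "j < q" for i j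
    using inj[OF \<beta>S \<beta>S] that \<beta> by (metis bij_betw_iff_bijections lessThan_iff)
  define \<sigma> where "\<sigma> i j k = inv_into {..<q} \<beta> (\<tau> (\<beta> i) (\<beta> j) (\<beta> k))" for i j k
  have lt: "\<sigma> i j k < q" and \<sigma>: "\<beta> i * \<beta> j - \<beta> k - \<beta> (\<sigma> i j k) \<in> M"
    if "i < q" "j < q" "k < q" for i j k
  proof -
    have t: "\<tau> (\<beta> i) (\<beta> j) (\<beta> k) \<in> \<beta> ` {..<q}"
      using \<tau> \<beta>S that \<beta> by (auto simp: bij_betw_def)
    show "\<sigma> i j k < q" using inv_into_into[OF t] by (simp add: \<sigma>_def)
    show "\<beta> i * \<beta> j - \<beta> k - \<beta> (\<sigma> i j k) \<in> M"
      using f_inv_into_f[OF t] \<tau> \<beta>S that by (simp add: \<sigma>_def)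
  qed
  show ?thesis
  proof (rule that[of \<sigma>], unfold_locales)
    show "q \<ge> 7" by fact
    show "\<sigma> a c b < q" if "a < q" "c < q" "b < q" for a c b using lt that .
    show "\<sigma> a c b = \<sigma> c a b" for a c b by (simp add: \<sigma>_def \<tau>_def mult.commute)
    show "\<sigma> a c (\<sigma> a c b) = b" if *: "a < q" "c < q" "b < q" for a c b
    proof (rule \<beta>inj)
      have "(\<beta> a * \<beta> c - \<beta> b - \<beta> (\<sigma> a c b)) -
          (\<beta> a * \<beta> c - \<beta> (\<sigma> a c b) - \<beta> (\<sigma> a c (\<sigma> a c b))) \<in> M"
        by (intro Mdiff \<sigma> lt *)
      then show "\<beta> (\<sigma> a c (\<sigma> a c b)) - \<beta> b \<in> M" by (simp add: algebra_simps)
    qed (use lt * in auto)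
    show "a = a' \<or> c = c'"
      if *: "a < q" "a' < q" "c < q" "c' < q" "b < q" "b' < q"
        and eq: "\<sigma> a c b = \<sigma> a' c b'" "\<sigma> a c' b = \<sigma> a' c' b'" for a a' c c' b b'
    proof -
      \<comment> \<open>In this combination of four congruences the terms in \<open>b\<close>,
        \<open>b'\<close> and \<open>\<sigma>\<close> cancel, which leaves
        \<open>(\<beta> a - \<beta> a') * (\<beta> c - \<beta> c')\<close>.\<close>
      have "((\<beta> a * \<beta> c - \<beta> b - \<beta> (\<sigma> a c b)) - (\<beta> a' * \<beta> c - \<beta> b' - \<beta> (\<sigma> a' c b')))
          - ((\<beta> a * \<beta> c' - \<beta> b - \<beta> (\<sigma> a c' b)) - (\<beta> a' * \<beta> c' - \<beta> b' - \<beta> (\<sigma> a' c' b'))) \<in> M"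
        by (intro Mdiff \<sigma> *)
      then have "(\<beta> a - \<beta> a') * (\<beta> c - \<beta> c') \<in> M" by (simp add: eq algebra_simps)
      moreover have "\<beta> a - \<beta> a' \<in> A" "\<beta> c - \<beta> c' \<in> A"
        using add minus SA \<beta>S * by (metis diff_conv_add_uminus)+
      ultimately show ?thesis using prime \<beta>inj * by blast
    qed
  qed
qed

section \<open>The block\<close>

lemma relpowp_map:
  assumes "(R ^^ n) x y" "\<And>x y. R x y \<Longrightarrow> S (f x) (f y)"
  shows "(S ^^ n) (f x) (f y)"
  using assms(1)
proof (induction n arbitrary: y)
  case (Suc n)
  then obtain z where "(R ^^ n) x z" "R z y" by auto
  then show ?case using Suc.IH assms(2) by auto
qed auto

lemma rtranclp_map:
  assumes "R\<^sup>*\<^sup>* x y" "\<And>x y. R x y \<Longrightarrow> S (f x) (f y)"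
  shows "S\<^sup>*\<^sup>* (f x) (f y)"
  using assms(1) by induction (auto intro: rtranclp.rtrancl_into_rtrancl assms(2))

lemma rtranclp_symp: "(\<And>x y. R x y \<Longrightarrow> R y x) \<Longrightarrow> R\<^sup>*\<^sup>* x y \<Longrightarrow> R\<^sup>*\<^sup>* y x"
  by (metis sympD sympI symp_rtranclp)

datatype vtx = Centre nat | Leaf nat nat

text \<open>The bounds below \<open>q\<close> are part of adjacency, so edges cannot leave
  \<open>block_verts q\<close>. The last two conditions remove the loops of the polarity and the
  matching between columns 0 and 1.\<close>

fun block_adj :: "nat \<Rightarrow> (nat \<Rightarrow> nat \<Rightarrow> nat \<Rightarrow> nat) \<Rightarrow> vtx \<Rightarrow> vtx \<Rightarrow> bool" where
  "block_adj q \<sigma> (Centre a) (Centre c) \<longleftrightarrow> False"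
| "block_adj q \<sigma> (Centre a) (Leaf c d) \<longleftrightarrow> a = c \<and> c < q \<and> d < q"
| "block_adj q \<sigma> (Leaf a b) (Centre c) \<longleftrightarrow> a = c \<and> a < q \<and> b < q"
| "block_adj q \<sigma> (Leaf a b) (Leaf c d) \<longleftrightarrow> a < q \<and> b < q \<and> c < q \<and> d < q \<and>
     d = \<sigma> a c b \<and> \<not> (a = c \<and> b = d) \<and> {a, c} \<noteq> {0, 1}"

definition block_verts :: "nat \<Rightarrow> vtx set" where
  "block_verts q = Centre ` {..<q} \<union> (\<lambda>(a, b). Leaf a b) ` ({..<q} \<times> {..<q})"

text \<open>A potential rather than the distance from \<open>Centre 0\<close>: it changes by at most
  1 along an edge and separates \<open>Centre 0\<close> from \<open>Centre 1\<close> by 4.\<close>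

fun block_height :: "vtx \<Rightarrow> nat" where
  "block_height (Centre a) = (if a = 0 then 0 else if a = 1 then 4 else 2)"
| "block_height (Leaf a b) = (if a = 0 then 1 else if a = 1 then 3 else 2)"

lemma card_block_verts: "card (block_verts q) = q\<^sup>2 + q" "finite (block_verts q)"
proof -
  have "card (Centre ` {..<q}) = q" by (subst card_image) (auto simp: inj_on_def)
  moreover have "card ((\<lambda>(a, b). Leaf a b) ` ({..<q} \<times> {..<q})) = q * q"
    by (subst card_image) (auto simp: inj_on_def)
  ultimately show "card (block_verts q) = q\<^sup>2 + q"
    unfolding block_verts_def by (subst card_Un_disjoint) (auto simp: power2_eq_square)
qed (simp add: block_verts_def)

lemma block_adj_verts: "block_adj q \<sigma> u v \<Longrightarrow> u \<in> block_verts q \<and> v \<in> block_verts q"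
  by (cases u; cases v) (auto simp: block_verts_def)

lemma block_adj_irrefl: "\<not> block_adj q \<sigma> u u"
  by (cases u) auto

text \<open>Heights 1 and 3 belong to the leaves of columns 0 and 1, between which the matching is
  deleted; the centres 0 and 1 see only these leaves.\<close>

lemma block_height_adj: "block_adj q \<sigma> u v \<Longrightarrow> block_height v \<le> Suc (block_height u)"
  by (cases u; cases v) (auto simp: doubleton_eq_iff)

lemma vtx_cases [consumes 1]:
  assumes "u \<in> block_verts q"
  obtains a where "u = Centre a" "a < q" | a b where "u = Leaf a b" "a < q" "b < q"
  using assms by (auto simp: block_verts_def)

section \<open>The block: no 4-cycles, short walks, edge-connectivity\<close>

context planar_operation
begin

abbreviation adj :: "vtx \<Rightarrow> vtx \<Rightarrow> bool" where "adj \<equiv> block_adj q \<sigma>"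

lemma adj_sym: "adj u v \<Longrightarrow> adj v u"
  using \<sigma>_invol \<sigma>_commute by (cases u; cases v) (auto simp: insert_commute)

text \<open>Deleted edges run between columns 0 and 1 and loops stay within a column, so a column
  from 2 on keeps its full matching to every other column.\<close>

lemma adj_leaf:
  "a < q \<Longrightarrow> b < q \<Longrightarrow> c < q \<Longrightarrow> 2 \<le> c \<Longrightarrow> c \<noteq> a \<Longrightarrow> adj (Leaf a b) (Leaf c (\<sigma> a c b))"
  using \<sigma>_less by (auto simp: doubleton_eq_iff)

text \<open>Two leaves of one column share only their centre; for leaves of different columns
  \<open>\<sigma>_planar\<close> puts all common neighbours into one column, which determines the
  leaf. A centre sees only its own column, where any leaf has at most one leaf neighbour.\<close>

lemma adj_C4_free:
  assumes "adj u v" "adj u w" "adj x v" "adj x w" "u \<noteq> x"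
  shows "v = w"
proof (cases u; cases x)
  fix a a' assume "u = Centre a" "x = Centre a'"
  then show ?thesis using assms by (cases v; cases w) auto
next
  fix a a' b assume "u = Centre a" "x = Leaf a' b"
  then show ?thesis using assms by (cases v; cases w) auto
next
  fix a a' b assume "u = Leaf a' b" "x = Centre a"
  then show ?thesis using assms by (cases v; cases w) auto
next
  fix a b a' b' assume ux: "u = Leaf a b" "x = Leaf a' b'"
  have lt: "a < q" "a' < q" "b < q" "b' < q"
    using assms block_adj_verts[of q \<sigma> u v] block_adj_verts[of q \<sigma> x v]
    by (auto simp: ux block_verts_def)
  have same: "b = b'" if "c < q" "\<sigma> a c b = \<sigma> a c b'" for c
    using that lt \<sigma>_invol by metis
  have neq: "a \<noteq> a' \<or> b \<noteq> b'" using assms(5) ux by auto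
  show ?thesis
  proof (cases v; cases w)
    fix c c' assume "v = Centre c" "w = Centre c'"
    then show ?thesis using assms ux by simp
  next
    fix c c' d assume "v = Centre c" "w = Leaf c' d"
    then have "a = a'" "c' < q" "\<sigma> a c' b = \<sigma> a' c' b'" using assms ux by simp_all
    then show ?thesis using same neq by blast
  next
    fix c c' d assume "v = Leaf c' d" "w = Centre c"
    then have "a = a'" "c' < q" "\<sigma> a c' b = \<sigma> a' c' b'" using assms ux by simp_all
    then show ?thesis using same neq by blast
  next
    fix c c' d d' assume vw: "v = Leaf c d" "w = Leaf c' d'"
    then have *: "c < q" "c' < q" "\<sigma> a c b = \<sigma> a' c b'" "\<sigma> a c' b = \<sigma> a' c' b'"
      and d: "d = \<sigma> a c b" "d' = \<sigma> a c' b"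
      using assms ux by simp_all
    then have "a = a' \<or> c = c'" using \<sigma>_planar lt by blast
    then show ?thesis using same neq * d vw by blast
  qed
qed

text \<open>At most \<open>q - 4\<close> columns of \<open>X\<close> together with 0, 1 and
  \<open>a\<close> cannot exhaust all \<open>q\<close> columns.\<close>

lemma fresh_column: 
  assumes "finite X" "card X \<le> q - 4"
  obtains c where "c < q" "2 \<le> c" "c \<noteq> a" "c \<notin> X"
proof -
  have "card (X \<union> {0, 1, a}) \<le> card X + card {0, 1, a}" by (rule card_Un_le)
  also have "card {0, 1, a} \<le> 3" by (simp add: card_insert_if)
  finally have "card (X \<union> {0, 1, a}) < card {..<q}" using assms q_ge by simp
  then have "\<not> {..<q} \<subseteq> X \<union> {0, 1, a}"
    using assms(1) by (metis card_mono finite.emptyI finite.insertI finite_Un not_le)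
  then obtain c where "c < q" "c \<notin> X \<union> {0, 1, a}" by auto
  then show ?thesis using that[of c] by auto
qed

text \<open>Every route uses a third column \<open>c\<close> with \<open>2 \<le> c\<close>, which is
  matched to the columns of both ends. Walks may repeat vertices, so coincidences such as
  \<open>u = v\<close> need no separate case.\<close>

lemma adj_diameter:
  assumes "u \<in> block_verts q" "v \<in> block_verts q"
  shows "\<exists>m\<le>4. (adj ^^ m) u v"
proof -
  have step3: "(adj ^^ 3) w z" if "adj w x" "adj x y" "adj y z" for w x y z
    using that by (auto simp: numeral_3_eq_3)
  have step4: "(adj ^^ 4) w z" if "adj w x" "adj x y" "adj y y'" "adj y' z" for w x y y' z
    using that by (auto simp: numeral_eq_Suc)
  have returning: "adj (Leaf c (\<sigma> a c b)) (Leaf a b)"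
    if "a < q" "b < q" "c < q" "2 \<le> c" "c \<noteq> a" for a b c
    using adj_sym[OF adj_leaf] that by blast
  have q0: "0 < q" using q_ge by simp
  have two_excluded: "\<exists>c<q. 2 \<le> c \<and> c \<noteq> a \<and> c \<noteq> a'" for a a'
    by (rule fresh_column[of "{a'}" a]) (use q_ge in auto)
  have CL: "(adj ^^ 3) (Centre a) (Leaf a' b')" "(adj ^^ 3) (Leaf a' b') (Centre a)"
    if *: "a < q" "a' < q" "b' < q" for a a' b'
  proof -
    obtain c where c: "c < q" "2 \<le> c" "c \<noteq> a" "c \<noteq> a'"
      using two_excluded by blast
    \<comment> \<open>Going backwards from \<open>Leaf a' b'\<close>: its neighbour in column
      \<open>c\<close>, then the neighbour of that leaf in column \<open>a\<close>.\<close>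
    define d where "d = \<sigma> a' c b'"
    define e where "e = \<sigma> a c d"
    have d: "d < q" and e: "e < q" using * c \<sigma>_less by (auto simp: d_def e_def)
    have "adj (Leaf a e) (Leaf c d)"
      using adj_leaf[of a e c] * c e d \<sigma>_invol by (auto simp: e_def)
    moreover have "adj (Leaf c d) (Leaf a' b')" using returning * c by (simp add: d_def)
    moreover have "adj (Centre a) (Leaf a e)" using * e by simp
    ultimately show "(adj ^^ 3) (Centre a) (Leaf a' b')" "(adj ^^ 3) (Leaf a' b') (Centre a)"
      using step3 adj_sym by meson+
  qed
  show ?thesis
    using assms(1)
  proof (cases rule: vtx_cases)
    case u: (1 a)
    show ?thesis using assms(2)
    proof (cases rule: vtx_cases)
      case v: (1 a')
      obtain c where c: "c < q" "2 \<le> c" "c \<noteq> a" "c \<noteq> a'"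
        using two_excluded by blast
      have "(adj ^^ 4) u v"
      proof (rule step4)
        \<comment> \<open>Both centres reach the meeting point \<open>Leaf c 0\<close> through one
          leaf of their own column; 0 is an arbitrary choice.\<close>
        show "adj u (Leaf a (\<sigma> a c 0))" using u c \<sigma>_less q0 by simp
        show "adj (Leaf a (\<sigma> a c 0)) (Leaf c 0)"
          using adj_leaf[of a "\<sigma> a c 0" c] u c \<sigma>_less \<sigma>_invol q0 by simp
        show "adj (Leaf c 0) (Leaf a' (\<sigma> a' c 0))"
          by (rule adj_sym) (use adj_leaf[of a' "\<sigma> a' c 0" c] v c \<sigma>_less \<sigma>_invol q0 in simp)
        show "adj (Leaf a' (\<sigma> a' c 0)) v" using v c \<sigma>_less q0 by simp
      qed
      then show ?thesis by blast
    next
      case (2 a' b')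
      then show ?thesis using CL(1) u by (intro exI[of _ 3]) simp
    qed
  next
    case u: (2 a b)
    show ?thesis using assms(2)
    proof (cases rule: vtx_cases)
      case (1 a')
      then show ?thesis using CL(2) u by (intro exI[of _ 3]) simp
    next
      case v: (2 a' b')
      obtain c where c: "c < q" "2 \<le> c" "c \<noteq> a" "c \<noteq> a'"
        using two_excluded by blast
      have "(adj ^^ 4) u v"
      proof (rule step4)
        \<comment> \<open>Two leaves meet through the centre of column \<open>c\<close>.\<close>
        show "adj u (Leaf c (\<sigma> a c b))" using adj_leaf u c by simp
        show "adj (Leaf c (\<sigma> a c b)) (Centre c)" "adj (Centre c) (Leaf c (\<sigma> a' c b'))"
          using u v c \<sigma>_less by auto
        show "adj (Leaf c (\<sigma> a' c b')) v" using returning v c by simp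
      qed
      then show ?thesis by blast
    qed
  qed
qed

text \<open>Everything is routed to columns with an untouched star: a leaf by one matching edge, a
  centre through a surviving edge of its star. Two such columns are joined by \<open>q\<close>
  matching edges, too many to be all deleted.\<close>

lemma adj_edge_connectivity:
  assumes F: "finite F" "card F < q - 6" and uv: "u \<in> block_verts q" "v \<in> block_verts q"
  shows "(\<lambda>x y. adj x y \<and> {x, y} \<notin> F)\<^sup>*\<^sup>* u v"
proof -
  define R where "R x y \<longleftrightarrow> adj x y \<and> {x, y} \<notin> F" for x y
  have R_sym: "R x y \<Longrightarrow> R y x" for x y
    using adj_sym by (auto simp: R_def insert_commute)
  have R_conv: "R\<^sup>*\<^sup>* y x" if "R\<^sup>*\<^sup>* x y" for x y
    using rtranclp_symp[OF R_sym that] .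
  define clean where "clean c \<longleftrightarrow> c < q \<and> 2 \<le> c \<and> (\<forall>b<q. {Centre c, Leaf c b} \<notin> F)" for c
  have star: "R\<^sup>*\<^sup>* (Leaf c b) (Centre c)" if "clean c" "b < q" for c b
    using that by (intro r_into_rtranclp) (auto simp: R_def clean_def insert_commute)
  have survive: "\<exists>b<q. f b \<notin> F" if "inj_on f {..<q}" for f
  proof (rule ccontr)
    assume "\<not> (\<exists>b<q. f b \<notin> F)"
    then have "card (f ` {..<q}) \<le> card F" using F(1) by (intro card_mono) auto
    then show False using card_image[OF that] F(2) by simp
  qed
  have leaf: "\<exists>c. clean c \<and> R\<^sup>*\<^sup>* (Leaf a b) (Centre c)" if ab: "a < q" "b < q" for a b
  proof -
    \<comment> \<open>Each column spoiled by \<open>F\<close> is charged to its own edge of \<open>F\<close>.\<close>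
    define P where "P c f \<longleftrightarrow> f \<in> F \<and>
      ((\<exists>b'<q. f = {Centre c, Leaf c b'}) \<or> f = {Leaf a b, Leaf c (\<sigma> a c b)})" for c f
    define X where "X = {c. c < q \<and> c \<noteq> a \<and> (\<exists>f. P c f)}"
    obtain g where g: "\<And>c. c \<in> X \<Longrightarrow> P c (g c)"
      using bchoice[of X P] by (auto simp: X_def)
    \<comment> \<open>The edge names its column, either by its centre or by its leaf outside column
      \<open>a\<close>.\<close>
    have "c = c'" if "P c f" "P c' f" "c \<noteq> a" "c' \<noteq> a" for c c' f
      using that by (auto simp: P_def doubleton_eq_iff)
    then have "inj_on g X" using g by (auto simp: inj_on_def X_def) metis
    moreover have "g ` X \<subseteq> F" using g by (auto simp: P_def)
    ultimately have "card X \<le> card F" using F(1) card_inj_on_le by blast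
    then have "card X \<le> q - 4" using F(2) by simp
    moreover have "finite X" by (simp add: X_def)
    ultimately obtain c where c: "c < q" "2 \<le> c" "c \<noteq> a" "c \<notin> X"
      using fresh_column[of X a] by metis
    have notP: "\<not> P c f" for f using c by (auto simp: X_def)
    have cl: "clean c" using c notP unfolding clean_def P_def by blast
    have "R (Leaf a b) (Leaf c (\<sigma> a c b))"
      using notP adj_leaf[of a b c] ab c by (auto simp: R_def P_def)
    then show ?thesis using star[OF cl] \<sigma>_less ab c cl by (meson converse_rtranclp_into_rtranclp)
  qed
  have centre: "\<exists>b<q. R (Centre a) (Leaf a b)" if "a < q" for a
  proof -
    have "inj_on (\<lambda>b. {Centre a, Leaf a b}) {..<q}" by (auto simp: inj_on_def doubleton_eq_iff)
    from survive[OF this] show ?thesis using that by (auto simp: R_def)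
  qed
  have to_clean: "\<exists>c. clean c \<and> R\<^sup>*\<^sup>* u (Centre c)" if "u \<in> block_verts q" for u
    using that
  proof (cases rule: vtx_cases)
    case (1 a)
    then show ?thesis using centre leaf by (meson converse_rtranclp_into_rtranclp)
  next
    case (2 a b)
    then show ?thesis using leaf by simp
  qed
  have clean_conn: "R\<^sup>*\<^sup>* (Centre c) (Centre c')" if c: "clean c" "clean c'" for c c'
  proof (cases "c = c'")
    case False
    have lt: "c < q" "c' < q" "2 \<le> c'" using c by (auto simp: clean_def)
    have "inj_on (\<lambda>b. {Leaf c b, Leaf c' (\<sigma> c c' b)}) {..<q}"
      using False by (auto simp: inj_on_def doubleton_eq_iff)
    from survive[OF this] obtain b where b: "b < q" "{Leaf c b, Leaf c' (\<sigma> c c' b)} \<notin> F" by auto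
    then have "R (Leaf c b) (Leaf c' (\<sigma> c c' b))"
      using adj_leaf[of c b c'] lt False by (auto simp: R_def)
    moreover have "R\<^sup>*\<^sup>* (Centre c) (Leaf c b)" using R_conv[OF star] c b by blast
    moreover have "R\<^sup>*\<^sup>* (Leaf c' (\<sigma> c c' b)) (Centre c')" using star c \<sigma>_less lt b by blast
    ultimately show ?thesis by (meson rtranclp.rtrancl_into_rtrancl rtranclp_trans)
  qed simp
  obtain c c' where "clean c" "clean c'" "R\<^sup>*\<^sup>* u (Centre c)" "R\<^sup>*\<^sup>* v (Centre c')"
    using to_clean uv by meson
  then have "R\<^sup>*\<^sup>* u v" using clean_conn[of c c'] R_conv by (meson rtranclp_trans)
  then show ?thesis unfolding R_def .
qed

end

section \<open>Chains of blocks\<close>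

lemma relpowp_sym:
  assumes "(R ^^ n) x y" "\<And>x y. R x y \<Longrightarrow> R y x"
  shows "(R ^^ n) y x"
  using assms(1)
proof (induction n arbitrary: y)
  case (Suc n)
  then obtain z where "(R ^^ n) x z" "R z y" by auto
  then show ?case using Suc.IH assms(2) relpowp_Suc_I2 by metis
qed auto

section \<open>Walks as lists, and criteria for diameter and edge-connectivity\<close>

lemma is_walk_snoc:
  assumes "is_walk V E xs" "{last xs, v} \<in> E" "v \<in> V"
  shows "is_walk V E (xs @ [v])"
proof -
  have "{(xs @ [v]) ! i, (xs @ [v]) ! Suc i} \<in> E" if i: "Suc i < length (xs @ [v])" for i
  proof (cases "Suc i < length xs")
    case True
    then show ?thesis using assms(1) by (simp add: is_walk_def nth_append)
  next
    case False
    then have "i = length xs - 1" "xs \<noteq> []" using i assms(1) by (auto simp: is_walk_def)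
    then show ?thesis using assms(2) by (simp add: nth_append last_conv_nth)
  qed
  then show ?thesis using assms by (auto simp: is_walk_def)
qed

lemma walk_of_relpowp:
  assumes "\<And>x y. R x y \<Longrightarrow> {x, y} \<in> E \<and> y \<in> V" "u \<in> V" "(R ^^ n) u v"
  shows "\<exists>xs. is_walk V E xs \<and> hd xs = u \<and> last xs = v \<and> length xs = Suc n"
  using assms(3)
proof (induction n arbitrary: v)
  case 0
  then show ?case using assms(2) by (intro exI[of _ "[u]"]) (auto simp: is_walk_def)
next
  case (Suc n)
  then obtain w where w: "(R ^^ n) u w" "R w v" by auto
  then obtain xs where "is_walk V E xs" "hd xs = u" "last xs = w" "length xs = Suc n"
    using Suc.IH by blast
  then show ?case using is_walk_snoc[of V E xs v] assms(1)[OF w(2)]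
    by (intro exI[of _ "xs @ [v]"]) (auto simp: hd_append is_walk_def)
qed

lemma connected_graph_of_rtranclp:
  assumes "V \<noteq> {}" "\<And>x y. R x y \<Longrightarrow> {x, y} \<in> E \<and> y \<in> V"
    and "\<And>u v. u \<in> V \<Longrightarrow> v \<in> V \<Longrightarrow> R\<^sup>*\<^sup>* u v"
  shows "connected_graph V E"
  unfolding connected_graph_def
  using assms(1) assms(3) rtranclp_imp_relpowp walk_of_relpowp[of R E V, OF assms(2)] by metis

text \<open>A list of \<open>Suc n\<close> vertices has \<open>n\<close> edges, each raising
  \<open>H\<close> by at most 1. Distances are bounded from below in this way.\<close>

lemma walk_height_le:
  assumes "is_walk V E xs" "\<And>x y. {x, y} \<in> E \<Longrightarrow> H y \<le> Suc (H x)"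
    and "length xs = Suc n"
  shows "H (last xs) \<le> H (hd xs) + n"
proof -
  have "i < length xs \<Longrightarrow> H (xs ! i) \<le> H (xs ! 0) + i" for i
  proof (induction i)
    case (Suc i)
    then have "{xs ! i, xs ! Suc i} \<in> E" using assms(1) by (simp add: is_walk_def)
    then show ?case using Suc assms(2) by fastforce
  qed simp
  from this[of n] show ?thesis
    using assms by (simp add: last_conv_nth hd_conv_nth is_walk_def)
qed

text \<open>The given walks bound every distance from above; the potential \<open>H\<close> shows
  that \<open>s\<close> and \<open>t\<close> attain the bound.\<close>

lemma diameter_eqI:
  assumes fin: "finite V"
    and up: "\<And>u v. u \<in> V \<Longrightarrow> v \<in> V \<Longrightarrow>
      \<exists>m\<le>d. \<exists>xs. is_walk V E xs \<and> hd xs = u \<and> last xs = v \<and> length xs = Suc m"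
    and H: "\<And>x y. {x, y} \<in> E \<Longrightarrow> H y \<le> Suc (H x)"
    and st: "s \<in> V" "t \<in> V" "H t = H s + d"
  shows "diameter V E = d"
proof -
  let ?P = "\<lambda>u v n. \<exists>xs. is_walk V E xs \<and> hd xs = u \<and> last xs = v \<and> length xs = Suc n"
  have le: "graph_dist V E u v \<le> d" if "u \<in> V" "v \<in> V" for u v
  proof -
    from up[OF that] obtain m where "m \<le> d" "?P u v m" by blast
    moreover have "graph_dist V E u v \<le> m"
      unfolding graph_dist_def by (rule Least_le) fact
    ultimately show ?thesis by simp
  qed
  have "?P s t (graph_dist V E s t)"
    unfolding graph_dist_def by (rule LeastI_ex) (use up[OF st(1,2)] in blast)
  then have "d \<le> graph_dist V E s t"
    using walk_height_le[of V E _ H, OF _ H] st(3) by fastforce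
  with le st have eq: "graph_dist V E s t = d" by (simp add: le_antisym)
  have "{graph_dist V E u v | u v. u \<in> V \<and> v \<in> V} = (\<lambda>(u, v). graph_dist V E u v) ` (V \<times> V)"
    by auto
  then have "finite {graph_dist V E u v | u v. u \<in> V \<and> v \<in> V}" using fin by simp
  then show ?thesis unfolding diameter_def
    using le eq st by (intro Max_eqI) auto
qed

text \<open>For \<open>LEAST\<close> to be attained some edge set must disconnect; with two distinct
  vertices \<open>E\<close> itself does.\<close>

lemma edge_connectivity_geI:
  assumes "\<And>F. F \<subseteq> E \<Longrightarrow> card F < l \<Longrightarrow> connected_graph V (E - F)"
    and "u \<in> V" "v \<in> V" "u \<noteq> v"
  shows "edge_connectivity V E \<ge> l"
proof -
  have "\<not> connected_graph V (E - E)"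
  proof
    assume "connected_graph V (E - E)"
    then obtain xs where xs: "is_walk V {} xs" "hd xs = u" "last xs = v"
      using assms(2,3) by (auto simp: connected_graph_def)
    then have "length xs = 1"
      by (metis One_nat_def Suc_lessI empty_iff is_walk_def length_greater_0_conv)
    then show False using xs assms(4) by (auto simp: length_Suc_conv)
  qed
  then have "\<exists>m. \<exists>F. F \<subseteq> E \<and> card F = m \<and> \<not> connected_graph V (E - F)" by blast
  from LeastI_ex[OF this] obtain F
    where "F \<subseteq> E" "card F = edge_connectivity V E" "\<not> connected_graph V (E - F)"
    unfolding edge_connectivity_def by auto
  then show ?thesis using assms(1)[of F] by force
qed

section \<open>Gluing copies of a block numbered from 0 to \<open>L\<close> at its end vertices 0
  and \<open>L\<close>\<close>

locale chain_block =
  fixes L :: nat and adj :: "nat \<Rightarrow> nat \<Rightarrow> bool" and h :: "nat \<Rightarrow> nat" and d l :: nat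
  assumes L_pos: "L > 0"
    and adj_le: "adj x y \<Longrightarrow> y \<le> L"
    and adj_sym: "adj x y \<Longrightarrow> adj y x"
    and adj_irrefl: "\<not> adj x x"
    and adj_C4: "adj u v \<Longrightarrow> adj u w \<Longrightarrow> adj x v \<Longrightarrow> adj x w \<Longrightarrow> u \<noteq> x \<Longrightarrow> v = w"
    and adj_diam: "x \<le> L \<Longrightarrow> y \<le> L \<Longrightarrow> \<exists>m\<le>d. (adj ^^ m) x y"
    and height: "adj x y \<Longrightarrow> h y \<le> Suc (h x)" "h 0 = 0" "h L = d"
    and adj_conn: "finite F \<Longrightarrow> card F < l \<Longrightarrow> x \<le> L \<Longrightarrow> y \<le> L \<Longrightarrow>
      (\<lambda>x y. adj x y \<and> {x, y} \<notin> F)\<^sup>*\<^sup>* x y"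
    and l_pos: "l > 0"
begin

text \<open>Copy \<open>i\<close> occupies the numbers from \<open>i * L\<close> to
  \<open>i * L + L\<close>. The overlap of consecutive intervals identifies vertex \<open>L\<close>
  of one copy with vertex 0 of the next, without forming a quotient.\<close>

definition block_edge :: "nat \<Rightarrow> nat \<Rightarrow> nat \<Rightarrow> bool" where
  "block_edge i u v \<longleftrightarrow> (\<exists>x y. adj x y \<and> u = i * L + x \<and> v = i * L + y)"

definition chain_adj :: "nat \<Rightarrow> nat \<Rightarrow> nat \<Rightarrow> bool" where
  "chain_adj k u v \<longleftrightarrow> (\<exists>i<k. block_edge i u v)"

definition chain_edges :: "nat \<Rightarrow> nat set set" where
  "chain_edges k = {{u, v} | u v. chain_adj k u v}"

lemma block_edge_sym: "block_edge i u v \<Longrightarrow> block_edge i v u"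
  using adj_sym by (auto simp: block_edge_def)

lemma chain_adj_sym: "chain_adj k u v \<Longrightarrow> chain_adj k v u"
  using block_edge_sym by (auto simp: chain_adj_def)

lemma chain_edges_iff: "{u, v} \<in> chain_edges k \<longleftrightarrow> chain_adj k u v"
  using chain_adj_sym by (auto simp: chain_edges_def doubleton_eq_iff)

lemma block_edge_bounds:
  assumes "block_edge i u v"
  shows "i * L \<le> u" "u \<le> Suc i * L"
  using assms adj_le adj_sym by (fastforce simp: block_edge_def)+

lemma chain_adj_le:
  assumes "chain_adj k u v"
  shows "u \<le> k * L" "v \<le> k * L"
proof -
  obtain i where i: "i < k" "block_edge i u v" using assms by (auto simp: chain_adj_def)
  then have "Suc i * L \<le> k * L" by (intro mult_le_mono1) simp
  then show "u \<le> k * L" "v \<le> k * L"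
    using block_edge_bounds(2)[OF i(2)] block_edge_bounds(2)[OF block_edge_sym[OF i(2)]]
    by linarith+
qed

lemma simple_graph_chain: "simple_graph {..k * L} (chain_edges k)"
  unfolding simple_graph_def
proof (intro conjI ballI)
  fix e assume "e \<in> chain_edges k"
  then obtain u v where e: "e = {u, v}" "chain_adj k u v" by (auto simp: chain_edges_def)
  then have "u \<noteq> v" using adj_irrefl by (auto simp: chain_adj_def block_edge_def)
  then show "card e = 2" using e by simp
  show "e \<subseteq> {..k * L}" using e chain_adj_le by auto
qed simp

text \<open>Going round a 4-cycle, the block index would have to return below the value it passed,
  which is only possible at the same cut vertex.\<close>

lemma cycle_block_index_le:
  assumes "block_edge i1 a b" "block_edge i2 b c" "block_edge i3 c e" "block_edge i4 e a"
    and "distinct [a, b, c, e]"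
  shows "i2 \<le> i1"
proof (rule ccontr)
  assume "\<not> i2 \<le> i1"
  \<comment> \<open>Where consecutive edges lie on different sides of the threshold
    \<open>i2\<close>, their common vertex is the cut vertex \<open>i2 * L\<close>.\<close>
  have low: "v = i2 * L"
    if "block_edge i u v" "block_edge j v w" "(i < i2) \<noteq> (j < i2)" for i j u v w
  proof -
    note bounds = block_edge_bounds[OF that(2)] block_edge_bounds[OF block_edge_sym[OF that(1)]]
    show ?thesis
    proof (cases "i < i2")
      case True
      then have "Suc i * L \<le> i2 * L" "i2 * L \<le> j * L" using that(3) by (auto intro: mult_le_mono1 simp del: mult_Suc)
      then show ?thesis using bounds by linarith
    next
      case False
      then have "Suc j * L \<le> i2 * L" "i2 * L \<le> i * L" using that(3) by (auto intro: mult_le_mono1 simp del: mult_Suc)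
      then show ?thesis using bounds by linarith
    qed
  qed
  have b: "b = i2 * L" using low[OF assms(1,2)] \<open>\<not> i2 \<le> i1\<close> by auto
  \<comment> \<open>The cycle has to come back across the threshold, so \<open>c\<close>,
    \<open>e\<close> or \<open>a\<close> would coincide with \<open>b\<close>.\<close>
  show False
    using low[OF assms(2,3)] low[OF assms(3,4)] low[OF assms(4,1)] b assms(5) \<open>\<not> i2 \<le> i1\<close>
    by (cases "i3 < i2"; cases "i4 < i2") auto
qed

text \<open>The index inequality, applied to the four rotations of the cycle, makes all block
  indices equal, so the cycle lies in a single block.\<close>

lemma C4_free_chain: "C4_free V (chain_edges k)"
  unfolding C4_free_def chain_edges_iff
proof (intro notI, elim exE conjE)
  fix a b c e
  assume dist: "distinct [a, b, c, e]"
    and "chain_adj k a b" "chain_adj k b c" "chain_adj k c e" "chain_adj k e a"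
  then obtain i1 i2 i3 i4 where
    e: "block_edge i1 a b" "block_edge i2 b c" "block_edge i3 c e" "block_edge i4 e a"
    by (auto simp: chain_adj_def)
  have "i2 \<le> i1" "i3 \<le> i2" "i4 \<le> i3" "i1 \<le> i4"
    using cycle_block_index_le[OF e] cycle_block_index_le[OF e(2,3,4,1)]
      cycle_block_index_le[OF e(3,4,1,2)] cycle_block_index_le[OF e(4,1,2,3)] dist by auto
  then have "i2 = i1" "i3 = i1" "i4 = i1" by auto
  with e obtain a' b' c' e' where "adj a' b'" "adj b' c'" "adj c' e'" "adj e' a'"
    and *: "a = i1 * L + a'" "b = i1 * L + b'" "c = i1 * L + c'" "e = i1 * L + e'"
    by (auto simp: block_edge_def)
  then have "b' = e'" using adj_C4[of a' b' e' c'] adj_sym dist by auto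
  then show False using dist * by simp
qed

text \<open>Division by \<open>L\<close> finds the block, except for the last vertex
  \<open>k * L\<close>, which is vertex \<open>L\<close> of block \<open>k - 1\<close>.\<close>

lemma chain_vertex_cases:
  assumes "u \<le> k * L" "k > 0"
  obtains i x where "i < k" "x \<le> L" "u = i * L + x"
proof (cases "u = k * L")
  case True
  then show ?thesis using that[of "k - 1" L] assms(2) by (cases k) auto
next
  case False
  then have "u div L < k" using assms L_pos by (simp add: less_mult_imp_div_less)
  then show ?thesis using that[of "u div L" "u mod L"] L_pos by (simp add: less_imp_le)
qed

text \<open>Each of the \<open>Suc j - i\<close> blocks involved is crossed in at most
  \<open>d\<close> steps.\<close>

lemma chain_relpowp_le:
  assumes "i \<le> j" "j < k" "x \<le> L" "y \<le> L"
  shows "\<exists>m\<le>d * (Suc j - i). (chain_adj k ^^ m) (i * L + x) (j * L + y)"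
  using assms(1,2,4)
proof (induction j arbitrary: y rule: dec_induct)
  case base
  obtain m where "m \<le> d" "(adj ^^ m) x y" using adj_diam assms(3) base by blast
  moreover have "chain_adj k (i * L + x) (i * L + y)" if "adj x y" for x y
    using that base by (auto simp: chain_adj_def block_edge_def)
  ultimately show ?case
    using relpowp_map[of m adj x y "chain_adj k" "(+) (i * L)"] by auto
next
  case (step j)
  \<comment> \<open>Aim for vertex \<open>L\<close> of block \<open>j\<close>, which is vertex 0 of
    block \<open>Suc j\<close>.\<close>
  obtain m where m: "m \<le> d * (Suc j - i)" "(chain_adj k ^^ m) (i * L + x) (j * L + L)"
    using step.IH[of L] step.prems by auto
  obtain m' where m': "m' \<le> d" "(adj ^^ m') 0 y" using adj_diam step.prems by blast
  have "chain_adj k (Suc j * L + x) (Suc j * L + y)" if "adj x y" for x y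
    using that step.prems unfolding chain_adj_def block_edge_def by blast
  then have "(chain_adj k ^^ m') (Suc j * L + 0) (Suc j * L + y)"
    using relpowp_map[OF m'(2), of "chain_adj k" "(+) (Suc j * L)"] by blast
  then have "(chain_adj k ^^ (m + m')) (i * L + x) (Suc j * L + y)"
    using relpowp_trans[OF m(2)] by (simp add: add.commute)
  moreover have "m + m' \<le> d * (Suc (Suc j) - i)"
    using m(1) m'(1) step.hyps by (simp add: Suc_diff_le)
  ultimately show ?case by blast
qed

lemma chain_relpowp:
  assumes "u \<le> k * L" "v \<le> k * L" "k > 0"
  shows "\<exists>m\<le>d * k. (chain_adj k ^^ m) u v"
proof -
  obtain i x where u: "i < k" "x \<le> L" "u = i * L + x" using chain_vertex_cases assms by metis
  obtain j y where v: "j < k" "y \<le> L" "v = j * L + y" using chain_vertex_cases assms by metis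
  have le: "d * (Suc j - i) \<le> d * k" "d * (Suc i - j) \<le> d * k" using u v by auto
  show ?thesis
  proof (cases "i \<le> j")
    case True
    then show ?thesis using chain_relpowp_le[of i j k x y] u v le by (meson le_trans)
  next
    case False
    then obtain m where "m \<le> d * k" "(chain_adj k ^^ m) v u"
      using chain_relpowp_le[of j i k y x] u v le by (metis le_trans nat_le_linear)
    then show ?thesis using relpowp_sym[of m "chain_adj k"] chain_adj_sym by blast
  qed
qed

definition chain_height :: "nat \<Rightarrow> nat" where
  "chain_height u = d * (u div L) + h (u mod L)"

text \<open>At \<open>x = L\<close> the quotient jumps to \<open>i + 1\<close>; the two values agree
  because \<open>h 0 = 0\<close> and \<open>h L = d\<close>.\<close>

lemma chain_height_eq: "x \<le> L \<Longrightarrow> chain_height (i * L + x) = d * i + h x"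
  using L_pos height by (cases "x = L") (auto simp: chain_height_def)

lemma chain_height_adj: "chain_adj k u v \<Longrightarrow> chain_height v \<le> Suc (chain_height u)"
proof -
  assume "chain_adj k u v"
  then obtain i x y where "adj x y" "u = i * L + x" "v = i * L + y"
    by (auto simp: chain_adj_def block_edge_def)
  moreover from this have "x \<le> L" "y \<le> L" using adj_le adj_sym by blast+
  ultimately show ?thesis using height(1) by (simp add: chain_height_eq)
qed

lemma diameter_chain:
  assumes "k > 0"
  shows "diameter {..k * L} (chain_edges k) = d * k"
proof (rule diameter_eqI[where H = chain_height and s = 0 and t = "k * L"])
  show "\<exists>m\<le>d * k. \<exists>xs. is_walk {..k * L} (chain_edges k) xs \<and> hd xs = u \<and> last xs = v \<and>
      length xs = Suc m" if uv: "u \<in> {..k * L}" "v \<in> {..k * L}" for u v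
  proof -
    obtain m where "m \<le> d * k" "(chain_adj k ^^ m) u v"
      using chain_relpowp[of u k v] assms uv by auto
    then show ?thesis
      using walk_of_relpowp[of "chain_adj k" "chain_edges k" "{..k * L}"] uv
        chain_edges_iff chain_adj_le(2) by (metis atMost_iff)
  qed
  show "chain_height (k * L) = chain_height 0 + d * k"
    using chain_height_eq[of 0 k] chain_height_eq[of 0 0] height by simp
qed (auto simp: chain_edges_iff chain_height_adj)

text \<open>Each copy loses fewer than \<open>l\<close> edges and stays connected; passing from
  block to block, every vertex then reaches 0.\<close>

lemma connected_chain_minus:
  assumes "F \<subseteq> chain_edges k" "card F < l" "k > 0"
  shows "connected_graph {..k * L} (chain_edges k - F)"
proof -
  define R where "R u v \<longleftrightarrow> chain_adj k u v \<and> {u, v} \<notin> F" for u v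
  have R_sym: "R u v \<Longrightarrow> R v u" for u v
    using chain_adj_sym by (auto simp: R_def insert_commute)
  have "chain_edges k \<subseteq> Pow {..k * L}" using simple_graph_chain by (auto simp: simple_graph_def)
  then have finF: "finite F" using assms(1) by (meson finite_Pow_iff finite_atMost finite_subset)
  have block: "R\<^sup>*\<^sup>* (i * L + x) (i * L + y)" if "i < k" "x \<le> L" "y \<le> L" for i x y
  proof -
    \<comment> \<open>The deleted edges of copy \<open>i\<close>, pulled back to block
      coordinates.\<close>
    define Fi where "Fi = image ((+) (i * L)) -` F"
    have inj: "inj (image ((+) (i * L)))" by (auto simp: inj_def inj_image_eq_iff)
    have "finite Fi" unfolding Fi_def using finF inj by (rule finite_vimageI)
    moreover have "card Fi < l"
      using card_vimage_inj_on_le[OF inj finF] assms(2) by (simp add: Fi_def)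
    ultimately have "(\<lambda>x y. adj x y \<and> {x, y} \<notin> Fi)\<^sup>*\<^sup>* x y" using adj_conn that by blast
    then show ?thesis
      by (rule rtranclp_map[where f = "(+) (i * L)"])
         (use that in \<open>auto simp: R_def chain_adj_def block_edge_def Fi_def\<close>)
  qed
  have to_0: "i < k \<Longrightarrow> x \<le> L \<Longrightarrow> R\<^sup>*\<^sup>* (i * L + x) 0" for i x
  proof (induction i arbitrary: x)
    case 0
    then show ?case using block[of 0 x 0] by simp
  next
    case (Suc i)
    have "R\<^sup>*\<^sup>* (Suc i * L + x) (i * L + L)" using block[of "Suc i" x 0] Suc by (simp add: add.commute)
    then show ?case using Suc.IH[of L] Suc.prems by (auto intro: rtranclp_trans)
  qed
  have to_0': "R\<^sup>*\<^sup>* u 0" if "u \<le> k * L" for u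
    using chain_vertex_cases[OF that assms(3)] to_0 by metis
  show ?thesis
  proof (rule connected_graph_of_rtranclp[of _ R])
    show "R\<^sup>*\<^sup>* u v" if "u \<in> {..k * L}" "v \<in> {..k * L}" for u v
      using to_0'[of u] rtranclp_symp[of R, OF R_sym to_0'[of v]] that by (auto intro: rtranclp_trans)
    show "{x, y} \<in> chain_edges k - F \<and> y \<in> {..k * L}" if "R x y" for x y
      using that chain_adj_le(2) by (auto simp: R_def chain_edges_iff)
  qed simp
qed

lemma edge_connectivity_chain:
  assumes "k > 0"
  shows "edge_connectivity {..k * L} (chain_edges k) \<ge> l"
  using connected_chain_minus assms L_pos
  by (intro edge_connectivity_geI[where u = 0 and v = "k * L"]) auto

lemma connected_chain: "k > 0 \<Longrightarrow> connected_graph {..k * L} (chain_edges k)"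
  using connected_chain_minus[of "{}" k] l_pos by simp

end

section \<open>Numbering the block and assembling the graph\<close>

lemma bij_betw_atMost_endpoints:
  fixes L :: nat
  assumes "finite B" "card B = Suc L" "u \<in> B" "v \<in> B" "u \<noteq> v"
  obtains \<beta> where "bij_betw \<beta> {..L} B" "\<beta> 0 = u" "\<beta> L = v"
proof -
  have "card (B - {u, v}) = L - 1" using assms by (simp add: card_Diff_subset)
  then obtain \<gamma> where \<gamma>: "bij_betw \<gamma> {1..<L} (B - {u, v})"
    using finite_same_card_bij[of "{1..<L}" "B - {u, v}"] assms by auto
  have L: "L > 0"
    using assms card_mono[of B "{u, v}"] by (cases L) auto
  define \<beta> where "\<beta> x = (if x = 0 then u else if x = L then v else \<gamma> x)" for x
  have "{..L} = insert 0 (insert L {1..<L})" using L by auto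
  moreover have "\<beta> ` {1..<L} = \<gamma> ` {1..<L}" by (intro image_cong) (auto simp: \<beta>_def)
  moreover have "\<beta> 0 = u" "\<beta> L = v" using L by (auto simp: \<beta>_def)
  ultimately have im: "\<beta> ` {..L} = B"
    using \<gamma> assms by (auto simp: bij_betw_def)
  then have "inj_on \<beta> {..L}" using assms by (intro eq_card_imp_inj_on) auto
  then show ?thesis using that[of \<beta>] im L by (auto simp: bij_betw_def \<beta>_def)
qed

text \<open>The \<open>q\<^sup>2 + q\<close> vertices are numbered from 0 to \<open>L\<close> with
  \<open>Centre 0\<close> first and \<open>Centre 1\<close> last, which makes these two the gluing
  vertices, at heights 0 and 4.\<close>

lemma (in planar_operation) chain_block_exists:
  obtains A h where "chain_block (q\<^sup>2 + q - 1) A h 4 (q - 6)"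
proof -
  define L where "L = q\<^sup>2 + q - 1"
  have L: "L > 0" "card (block_verts q) = Suc L"
    using q_ge by (auto simp: L_def card_block_verts(1))
  obtain \<beta> where \<beta>: "bij_betw \<beta> {..L} (block_verts q)" "\<beta> 0 = Centre 0" "\<beta> L = Centre 1"
    using bij_betw_atMost_endpoints[OF card_block_verts(2) L(2), of "Centre 0" "Centre 1"] q_ge
    by (auto simp: block_verts_def)
  define \<iota> where "\<iota> = inv_into {..L} \<beta>"
  have \<iota>: "\<iota> (\<beta> x) = x" "\<beta> x \<in> block_verts q" if "x \<le> L" for x
    using \<beta>(1) that by (auto simp: \<iota>_def bij_betw_def)
  have \<iota>': "\<beta> (\<iota> u) = u" "\<iota> u \<le> L" if "u \<in> block_verts q" for u
    using \<beta>(1) that inv_into_into[of u \<beta> "{..L}"]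
    by (auto simp: \<iota>_def bij_betw_def f_inv_into_f)
  define A where "A x y \<longleftrightarrow> x \<le> L \<and> y \<le> L \<and> adj (\<beta> x) (\<beta> y)" for x y
  have A_map: "A (\<iota> u) (\<iota> v)" if "adj u v" for u v
    using that block_adj_verts \<iota>' by (auto simp: A_def)
  have "chain_block L A (block_height \<circ> \<beta>) 4 (q - 6)"
  proof
    show "L > 0" by (fact L)
    show "q - 6 > 0" using q_ge by simp
    show "A x y \<Longrightarrow> y \<le> L" for x y by (simp add: A_def)
    show "A x y \<Longrightarrow> A y x" for x y using adj_sym by (simp add: A_def)
    show "\<not> A x x" for x by (simp add: A_def block_adj_irrefl)
    show "v = w" if "A u v" "A u w" "A x v" "A x w" "u \<noteq> x" for u v w x
    proof -
      have "\<beta> u \<noteq> \<beta> x" using that \<iota>(1) unfolding A_def by metis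
      then have "\<beta> v = \<beta> w" using that adj_C4_free unfolding A_def by blast
      then show ?thesis using that \<iota>(1) unfolding A_def by metis
    qed
    show "\<exists>m\<le>4. (A ^^ m) x y" if "x \<le> L" "y \<le> L" for x y
      using adj_diameter[of "\<beta> x" "\<beta> y"] \<iota> that relpowp_map[of _ adj "\<beta> x" "\<beta> y" A \<iota>] A_map by metis
    show "(block_height \<circ> \<beta>) y \<le> Suc ((block_height \<circ> \<beta>) x)" if "A x y" for x y
      using that block_height_adj by (auto simp: A_def)
    show "(block_height \<circ> \<beta>) 0 = 0" "(block_height \<circ> \<beta>) L = 4" by (simp_all add: \<beta>)
    show "(\<lambda>x y. A x y \<and> {x, y} \<notin> F)\<^sup>*\<^sup>* x y"
      if F: "finite F" "card F < q - 6" and xy: "x \<le> L" "y \<le> L" for F x y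
    proof -
      \<comment> \<open>The deleted edges are carried over to \<open>vtx\<close>; an image has at
        most as many elements as \<open>F\<close>.\<close>
      define F' where "F' = image \<beta> ` F"
      have "finite F'" "card F' < q - 6"
        using F card_image_le[OF F(1), of "image \<beta>"] by (auto simp: F'_def)
      then have "(\<lambda>u v. adj u v \<and> {u, v} \<notin> F')\<^sup>*\<^sup>* (\<beta> x) (\<beta> y)"
        using adj_edge_connectivity \<iota>(2) xy by blast
      then have "(\<lambda>x y. A x y \<and> {x, y} \<notin> F)\<^sup>*\<^sup>* (\<iota> (\<beta> x)) (\<iota> (\<beta> y))"
      proof (rule rtranclp_map)
        fix u v assume uv: "adj u v \<and> {u, v} \<notin> F'"
        then have "\<beta> ` {\<iota> u, \<iota> v} = {u, v}" using block_adj_verts \<iota>' by auto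
        then have "{\<iota> u, \<iota> v} \<notin> F" using uv unfolding F'_def by (metis imageI)
        then show "A (\<iota> u) (\<iota> v) \<and> {\<iota> u, \<iota> v} \<notin> F" using uv A_map by blast
      qed
      then show ?thesis using \<iota>(1) xy by simp
    qed
  qed
  then show ?thesis using that by (simp add: L_def)
qed

theorem theorem3:
  fixes q k :: nat
  assumes "prime_power q" and "odd q" and "q \<ge> 7" and "k \<ge> 1"
  shows "\<exists>(V :: nat set) E. simple_graph V E \<and> connected_graph V E \<and> C4_free V E \<and>
           card V = (q^2 + q - 1) * k + 1 \<and> diameter V E = 4 * k \<and>
           int (edge_connectivity V E) \<ge> int q - 6"
proof -
  obtain \<sigma> where \<sigma>: "planar_operation q \<sigma>"
    by (rule planar_operation_exists[OF assms(1,2,3)])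
  obtain A h where "chain_block (q\<^sup>2 + q - 1) A h 4 (q - 6)"
    by (rule planar_operation.chain_block_exists[OF \<sigma>])
  then interpret chain_block "q\<^sup>2 + q - 1" A h 4 "q - 6" .
  \<comment> \<open>Neighbouring copies share a vertex, so each copy adds
    \<open>q\<^sup>2 + q - 1\<close> new vertices to the initial vertex 0.\<close>
  let ?V = "{..k * (q\<^sup>2 + q - 1)}"
  have k: "k > 0" using assms(4) by simp
  have "int (edge_connectivity ?V (chain_edges k)) \<ge> int q - 6"
    using edge_connectivity_chain[OF k] by linarith
  moreover have "card ?V = (q^2 + q - 1) * k + 1" by (simp add: mult.commute)
  ultimately show ?thesis
    using simple_graph_chain connected_chain[OF k] C4_free_chain diameter_chain[OF k] by blast
qed

end
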